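(* Let $\mathbb{K}$ be a field of characteristic zero and let $\mathcal{A}$ be a supersolvable projective line arrangement in $\mathbf{P}^2_{\mathbb{K}}$ with a modular point $p\in L_2(\mathcal{A})$, $\mu(p)=m-1\ge1$. Let $H\in\mathcal{A}$ and $\mathcal{A}':=\mathcal{A}\setminus\{H\}$, and assume that $\mathcal{A}'$ is not a pencil. Then $n_2(\mathcal{A}')>0$.
   Context: A line arrangement in $\mathbf{P}^2_{\mathbb{K}}$ is a finite set of lines; $\mathcal{A}$ is assumed essential (its lines do not all pass through one common point). An arrangement is a pencil if all its lines pass through one common point. $L_2(\mathcal{A})$ is the set of points that are intersections of at least two lines of $\mathcal{A}$. For $p\in L_2(\mathcal{A})$, $\mathcal{A}_p=\{L\in\mathcal{A}\mid p\in L\}$, $\mu(p)=|\mathcal{A}_p|-1$. A double point of an arrangement $\mathcal{B}$ is a point through which exactly two lines of $\mathcal{B}$ pass; $n_2(\mathcal{B})$ is the number of double points of $\mathcal{B}$. $\mathcal{A}$ is supersolvable with modular point $p$ if for all distinct $L,L'\in\mathcal{A}\setminus\mathcal{A}_p$ there is a unique $K\in\mathcal{A}_p$ with $L\cap L'\subset K$. *)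

theory Defs
  imports "HOL-Analysis.Cartesian_Space"
begin

text \<open>A point of the projective plane over \<open>'k\<close> is a one-dimensional subspace of \<open>'k ^ 3\<close>;
  a line is the set of all points lying in some two-dimensional subspace.\<close>

type_synonym 'k ppoint = "('k ^ 3) set"
type_synonym 'k pline = "'k ppoint set"

definition proj_points :: "('k::field) ppoint set" where
  "proj_points = {P. vec.subspace P \<and> vec.dim P = 1}"

definition proj_lines :: "('k::field) pline set" where
  "proj_lines = {{P \<in> proj_points. P \<subseteq> W} | W. vec.subspace W \<and> vec.dim W = 2}"

definition line_arrangement :: "('k::field) pline set \<Rightarrow> bool" where
  "line_arrangement \<A> \<longleftrightarrow> finite \<A> \<and> \<A> \<subseteq> proj_lines"

text \<open>The empty arrangement counts as a pencil.\<close>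

definition pencil :: "('k::field) pline set \<Rightarrow> bool" where
  "pencil \<A> \<longleftrightarrow> (\<exists>q \<in> proj_points. \<forall>L \<in> \<A>. q \<in> L)"

definition essential :: "('k::field) pline set \<Rightarrow> bool" where
  "essential \<A> \<longleftrightarrow> \<not> pencil \<A>"

definition lines_through :: "('k::field) pline set \<Rightarrow> 'k ppoint \<Rightarrow> 'k pline set" where
  "lines_through \<A> p = {L \<in> \<A>. p \<in> L}"

definition L2 :: "('k::field) pline set \<Rightarrow> 'k ppoint set" where
  "L2 \<A> = {q \<in> proj_points. \<exists>L \<in> \<A>. \<exists>L' \<in> \<A>. L \<noteq> L' \<and> q \<in> L \<inter> L'}"

definition mu :: "('k::field) pline set \<Rightarrow> 'k ppoint \<Rightarrow> nat" where
  "mu \<A> p = card (lines_through \<A> p) - 1"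

definition double_points :: "('k::field) pline set \<Rightarrow> 'k ppoint set" where
  "double_points \<A> = {q \<in> proj_points. card (lines_through \<A> q) = 2}"

definition n2 :: "('k::field) pline set \<Rightarrow> nat" where
  "n2 \<A> = card (double_points \<A>)"

definition supersolvable_with_modular_point :: "('k::field) pline set \<Rightarrow> 'k ppoint \<Rightarrow> bool" where
  "supersolvable_with_modular_point \<A> p \<longleftrightarrow>
     p \<in> L2 \<A> \<and>
     (\<forall>L \<in> \<A> - lines_through \<A> p. \<forall>L' \<in> \<A> - lines_through \<A> p.
        L \<noteq> L' \<longrightarrow> (\<exists>!K. K \<in> lines_through \<A> p \<and> L \<inter> L' \<subseteq> K))"

end

(*
  Choose coordinates in which the lines through p are x = a for a in a finite set D of m elements
  (none at infinity); the other lines are graphs y = f(x) of linear polynomials, and modularity says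
  that any two of these agree at a point of D.  The key claim is that every such f has an a in D at
  which no other one agrees with it.

  Shift so that f = 0 and put q = prod (x - a).  Newton interpolation over K[x] gives a polynomial
  g(x,y) of total degree < m with g(x, f(x)) = f q' - m f' q for all the lines f (the restriction of
  a degree m - 1 logarithmic derivation of the arrangement).  If for every a in D some other f
  vanishes at a, the coefficient h(x) of y in g satisfies h(a) = (1 - m) q'(a) on D.  Both
  sides have degree < m, so h = (1 - m) q'; but deg h < m - 1, whereas (1 - m) q' has leading
  coefficient (1 - m) m, which is nonzero in characteristic zero.

  If H does not pass through p, the claim for the lines of A' gives a double point.  If it does and
  there were no double point, the claim for A would place every lonely point on H, so no two lines
  off p meet on H, A' is again supersolvable at p, and the claim for A' gives a contradiction (or A'
  is a pencil, when only one line through p is left).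
*)
theory Submission
  imports Defs "HOL-Computational_Algebra.Polynomial"
begin

section \<open>Powers of linear factors, and the total degree of bivariate polynomials\<close>

lemma linear_power_dvd_cancel:
  fixes T R :: "'a::idom poly"
  assumes "[:- a, 1:] ^ n dvd T * R" "poly T a \<noteq> 0"
  shows "[:- a, 1:] ^ n dvd R"
proof (cases "R = 0")
  case False
  have "T \<noteq> 0" using assms(2) by auto
  with False have "n \<le> order a (T * R)" using assms(1) by (simp add: order_divides)
  also have "\<dots> = order a R"
    using False \<open>T \<noteq> 0\<close> assms(2) by (simp add: order_mult order_0I)
  finally show ?thesis by (simp add: order_divides)
qed simp

text \<open>The factors belong to distinct roots, so each one already split off is nonzero at the
  next root and can be cancelled. The coefficient ring is an integral domain because
  \<open>'k\<close> and \<open>'k poly\<close> both occur below.\<close>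

lemma prod_linear_power_dvd:
  fixes R :: "'a::idom poly"
  assumes "finite D" "\<And>a. a \<in> D \<Longrightarrow> [:- a, 1:] ^ e a dvd R"
  shows "(\<Prod>a\<in>D. [:- a, 1:] ^ e a) dvd R"
  using assms
proof (induction D rule: finite_induct)
  case (insert b D)
  then obtain R' where R': "R = (\<Prod>a\<in>D. [:- a, 1:] ^ e a) * R'" by (auto elim: dvdE)
  have "poly (\<Prod>a\<in>D. [:- a, 1:] ^ e a) b \<noteq> 0"
    using insert.hyps by (auto simp: poly_prod)
  with insert.prems R' have "[:- b, 1:] ^ e b dvd R'"
    using linear_power_dvd_cancel by blast
  then show ?case using insert.hyps R' by (simp add: mult.commute mult_dvd_mono)
qed simp

lemma degree_le_1E:
  assumes "degree f \<le> 1"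
  obtains c d where "f = [:d, c:]"
proof -
  obtain d g where g: "f = pCons d g" by (cases f)
  with assms have "degree g = 0" by (auto split: if_splits)
  with g show ?thesis using that by (auto elim: degree_eq_zeroE)
qed

lemma degree_le_1_expand:
  fixes f :: "'a::idom poly"
  assumes "degree f \<le> 1"
  shows "f = [:poly f a:] + pderiv f * [:- a, 1:]"
proof -
  obtain c d where "f = [:d, c:]" using assms by (rule degree_le_1E)
  then show ?thesis by (simp add: pderiv_pCons)
qed

text \<open>A bivariate polynomial is read as a polynomial in y over K[x]:
  \<open>coeff (coeff g j) i\<close> belongs to x^i y^j, and \<open>poly g f\<close> substitutes y =
  f(x).\<close>

definition total_degree_less :: "nat \<Rightarrow> 'a::zero poly poly \<Rightarrow> bool" where
  "total_degree_less m g \<longleftrightarrow> (\<forall>i j. coeff (coeff g j) i \<noteq> 0 \<longrightarrow> i + j < m)"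

lemma total_degree_less_add:
  fixes g h :: "'a::comm_ring poly poly"
  assumes "total_degree_less m g" "total_degree_less m h"
  shows "total_degree_less m (g + h)"
  using assms unfolding total_degree_less_def by (metis add.left_neutral coeff_add)

lemma total_degree_less_smult:
  fixes g :: "'a::idom poly poly"
  assumes "total_degree_less m g"
  shows "total_degree_less (degree e + m) (smult e g)"
  unfolding total_degree_less_def
proof (intro allI impI)
  fix i j assume nz: "coeff (coeff (smult e g) j) i \<noteq> 0"
  let ?c = "coeff g j"
  have "?c \<noteq> 0" using nz by auto
  then have "degree ?c + j < m" using assms by (simp add: total_degree_less_def)
  moreover have "i \<le> degree e + degree ?c"
    using nz by (metis coeff_smult degree_mult_le le_degree le_trans)
  ultimately show "i + j < degree e + m" by linarith
qed

lemma total_degree_less_mono: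
  "total_degree_less m g \<Longrightarrow> m \<le> n \<Longrightarrow> total_degree_less n g"
  by (force simp: total_degree_less_def)

text \<open>Each factor is y - f(x) with f at most linear, so it adds at most one to the total
  degree; \<open>Suc\<close> turns this into a strict bound.\<close>

lemma total_degree_less_prod:
  fixes S :: "'a::idom poly set"
  assumes "finite S" "\<And>f. f \<in> S \<Longrightarrow> degree f \<le> 1"
  shows "total_degree_less (Suc (card S)) (\<Prod>f\<in>S. [:- f, 1:])"
  using assms
proof (induction S rule: finite_induct)
  case empty
  show ?case by (auto simp: total_degree_less_def coeff_1 split: if_splits)
next
  case (insert k S)
  let ?P = "\<Prod>f\<in>S. [:- f, 1:]"
  have IH: "total_degree_less (Suc (card S)) ?P" using insert by blast
  have "total_degree_less (Suc (Suc (card S))) (pCons 0 ?P)"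
    using IH by (auto simp: total_degree_less_def coeff_pCons split: nat.splits)
  moreover have "total_degree_less (Suc (Suc (card S))) (smult (- k) ?P)"
    using total_degree_less_mono[OF total_degree_less_smult[OF IH, of "- k"]] insert.prems[of k] by simp
  moreover have "[:- k, 1:] * ?P = smult (- k) ?P + pCons 0 ?P"
    by (simp add: mult_pCons_left)
  ultimately have "total_degree_less (Suc (Suc (card S))) ([:- k, 1:] * ?P)"
    by (metis total_degree_less_add)
  then show ?case using insert.hyps by simp
qed

text \<open>Replacing y by a polynomial of degree at most one turns x^i y^j into something of degree
  at most i + j.\<close>

lemma degree_poly_total_degree_less:
  fixes g :: "'a::idom poly poly"
  assumes g: "total_degree_less m g" and f: "degree f \<le> 1" and m: "m > 0"
  shows "degree (poly g f) < m"
proof -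
  have "degree (coeff g j * f ^ j) \<le> m - 1" for j
  proof (cases "coeff g j = 0")
    case False
    then have "degree (coeff g j) + j < m" using g by (simp add: total_degree_less_def)
    moreover have "degree (f ^ j) \<le> j"
      using degree_power_le[of f j] f by (metis le_trans mult_le_mono1 nat_mult_1)
    ultimately show ?thesis
      using degree_mult_le[of "coeff g j" "f ^ j"] by linarith
  qed simp
  then have "degree (poly g f) \<le> m - 1"
    unfolding poly_altdef by (intro degree_sum_le) auto
  with m show ?thesis by simp
qed


section \<open>Interpolating the logarithmic derivation, and the lonely root\<close>

context
  fixes D :: "'k::field_char_0 set" and q :: "'k poly" and m :: nat
  assumes D: "finite D" "m = card D" "m \<ge> 2"
    and q: "q = (\<Prod>a\<in>D. [:- a, 1:])"
begin

text \<open>Homogenising \<open>q\<close> to \<open>Q(x, z)\<close>, this is the derivative of the linear form \<open>f\<close> along the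
  vector field \<open>(- Q\<^sub>z, Q\<^sub>x)\<close> tangent to the lines \<open>x = a z\<close>, \<open>a \<in> D\<close>, evaluated at \<open>z = 1\<close>.
  This choice, rather than \<open>f' q\<close>, brings the degree below \<open>m\<close>.\<close>

definition field_value :: "'k poly \<Rightarrow> 'k poly" where
  "field_value f = f * pderiv q - of_nat m * pderiv f * q"

lemma q_coeffs: "degree q = m" "coeff q m = 1"
proof -
  show "degree q = m" using D by (simp add: q degree_prod_sum_eq)
  then show "coeff q m = 1" using lead_coeff_prod[of "\<lambda>a. [:- a, 1:]" D] by (simp add: q)
qed

text \<open>For f = c x + d both terms of \<open>field_value f\<close> have x^m coefficient m c, so
  these cancel; this is the factor \<open>of_nat i - of_nat m\<close> in the computation.\<close>

lemma degree_field_value: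
  assumes "degree f \<le> 1"
  shows "degree (field_value f) < m"
proof -
  obtain c d where f: "f = [:d, c:]" using assms by (rule degree_le_1E)
  show ?thesis
  proof (rule degree_lessI)
    show "\<forall>i\<ge>m. coeff (field_value f) i = 0"
    proof (intro allI impI)
      fix i assume i: "m \<le> i"
      then obtain n where n: "i = Suc n" using D by (cases i) auto
      have high: "coeff q j = 0" if "j > m" for j using that q_coeffs(1) by (simp add: coeff_eq_0)
      have target: "field_value f = smult d (pderiv q) + pCons 0 (smult c (pderiv q)) - smult (of_nat m * c) q"
        by (simp add: field_value_def f pderiv_pCons of_nat_poly mult.commute)
      have "coeff (field_value f) i = d * (of_nat (Suc i) * coeff q (Suc i)) + (of_nat i - of_nat m) * c * coeff q i"
        unfolding target by (simp add: n coeff_pderiv algebra_simps)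
      also have "\<dots> = 0" using i high by (cases "i = m") auto
      finally show "coeff (field_value f) i = 0" .
    qed
  qed (use D in auto)
qed

text \<open>Newton interpolation stays polynomial: near \<open>a \<in> D\<close>, the members of \<open>S\<close> sharing the value
  \<open>b\<close> at \<open>a\<close> are interpolated by \<open>y q' - m (q / (x - a)) (y - b)\<close>, which has no denominators.\<close>

lemma prod_diff_dvd:
  assumes S: "finite S" "\<And>f. f \<in> S \<Longrightarrow> degree f \<le> 1"
    and l: "degree l \<le> 1" "l \<notin> S"
    and meet: "\<And>k. k \<in> S \<Longrightarrow> \<exists>a\<in>D. poly k a = poly l a"
    and g: "\<And>f. f \<in> S \<Longrightarrow> poly g f = field_value f"
  shows "(\<Prod>k\<in>S. l - k) dvd field_value l - poly g l"
proof -
  obtain \<alpha> where \<alpha>: "\<And>k. k \<in> S \<Longrightarrow> \<alpha> k \<in> D \<and> poly k (\<alpha> k) = poly l (\<alpha> k)"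
    using meet by metis
  \<comment> \<open>Two distinct polynomials of degree at most one that agree at
    \<open>\<alpha> k\<close> differ by a nonzero constant times x - \<open>\<alpha> k\<close>. The
    divisibility can therefore be checked separately at each a in \<open>D\<close>.\<close>
  have "\<exists>c. is_unit c \<and> l - k = c * [:- \<alpha> k, 1:]" if k: "k \<in> S" for k
  proof (intro exI conjI)
    have deg: "degree (l - k) \<le> 1" using k S l by (simp add: degree_diff_le)
    show lin: "l - k = pderiv (l - k) * [:- \<alpha> k, 1:]"
      using degree_le_1_expand[OF deg, of "\<alpha> k"] \<alpha>[OF k] by (simp del: mult_pCons_right)
    have "degree (pderiv (l - k)) = 0" using deg by (simp add: degree_pderiv)
    moreover have "pderiv (l - k) \<noteq> 0"
    proof
      assume "pderiv (l - k) = 0"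
      with lin have "l - k = 0" by (metis mult_zero_left)
      with k l show False by simp
    qed
    ultimately show "is_unit (pderiv (l - k))" by (metis is_unit_iff_degree)
  qed
  then obtain c where unit: "\<And>k. k \<in> S \<Longrightarrow> is_unit (c k)"
    and lin: "\<And>k. k \<in> S \<Longrightarrow> l - k = c k * [:- \<alpha> k, 1:]" by metis
  have "[:- a, 1:] ^ card {k \<in> S. \<alpha> k = a} dvd field_value l - poly g l" if a: "a \<in> D" for a
  proof -
    let ?C = "{k \<in> S. \<alpha> k = a}"
    define b where "b = poly l a"
    define r where "r = (\<Prod>a'\<in>D - {a}. [:- a', 1:])"
    have q': "q = [:- a, 1:] * r" using a D by (simp add: q r_def prod.remove)
    define G where "G = g - [:of_nat m * r * [:b:], pderiv q - of_nat m * r:]"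
    \<comment> \<open>For f with f(a) = b, the product f' (x - a) equals f - b, which makes
      \<open>field_value f\<close> a polynomial expression in f without f'.\<close>
    have G: "poly G f = poly g f - field_value f" if "degree f \<le> 1" "poly f a = b" for f
    proof -
      have f: "f - [:b:] = pderiv f * [:- a, 1:]"
        using degree_le_1_expand[OF that(1), of a] that(2) by (simp add: algebra_simps)
      have "field_value f = f * pderiv q - of_nat m * r * (pderiv f * [:- a, 1:])"
        unfolding field_value_def by (subst (2) q') (simp only: mult_ac)
      also have "\<dots> = f * pderiv q - of_nat m * r * (f - [:b:])" by (simp only: f)
      finally show ?thesis by (simp add: G_def algebra_simps)
    qed
    \<comment> \<open>\<open>G\<close> vanishes at y = k for each k in \<open>?C\<close>.
      Substituting y = l into the resulting factorisation yields the factors l - k, each divisible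
      by x - a.\<close>
    have "(\<Prod>k\<in>?C. [:- k, 1:] ^ 1) dvd G"
    proof (rule prod_linear_power_dvd)
      fix k assume k: "k \<in> ?C"
      then have "poly G k = 0" using G[of k] S g \<alpha> by (auto simp: b_def)
      then show "[:- k, 1:] ^ 1 dvd G" by (simp add: poly_eq_0_iff_dvd)
    qed (use S in auto)
    then obtain s where "G = (\<Prod>k\<in>?C. [:- k, 1:]) * s" by (auto elim: dvdE)
    then have "poly G l = (\<Prod>k\<in>?C. l - k) * poly s l" by (simp add: poly_prod)
    moreover have "poly G l = - (field_value l - poly g l)" using G[OF l(1)] by (simp add: b_def)
    ultimately have "(\<Prod>k\<in>?C. l - k) dvd - (field_value l - poly g l)" by (metis dvd_triv_left)
    moreover have "(\<Prod>k\<in>?C. [:- a, 1:]) dvd (\<Prod>k\<in>?C. l - k)"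
    proof (rule prod_dvd_prod)
      fix k assume "k \<in> ?C"
      then show "[:- a, 1:] dvd l - k" using lin[of k] by (simp del: mult_pCons_right)
    qed
    ultimately have "[:- a, 1:] ^ card ?C dvd - (field_value l - poly g l)"
      unfolding prod_constant by (rule dvd_trans[rotated])
    then show ?thesis by (simp only: dvd_minus_iff)
  qed
  then have "(\<Prod>a\<in>D. [:- a, 1:] ^ card {k \<in> S. \<alpha> k = a}) dvd field_value l - poly g l"
    using D by (intro prod_linear_power_dvd) auto
  also have "(\<Prod>a\<in>D. [:- a, 1:] ^ card {k \<in> S. \<alpha> k = a}) =
      (\<Prod>a\<in>D. \<Prod>k\<in>{k \<in> S. \<alpha> k = a}. [:- \<alpha> k, 1:])"
    by (intro prod.cong refl) simp
  also have "\<dots> = (\<Prod>k\<in>S. [:- \<alpha> k, 1:])"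
    using S D \<alpha> by (intro prod.group) auto
  finally have "(\<Prod>k\<in>S. [:- \<alpha> k, 1:]) dvd field_value l - poly g l" .
  moreover have "(\<Prod>k\<in>S. l - k) = (\<Prod>k\<in>S. c k) * (\<Prod>k\<in>S. [:- \<alpha> k, 1:])"
    unfolding prod.distrib[symmetric] using lin by (intro prod.cong) auto
  moreover have "is_unit (\<Prod>k\<in>S. c k)"
    using prod_dvd_prod[of S c "\<lambda>_. 1"] unit by simp
  ultimately show ?thesis by (simp add: mult_unit_dvd_iff')
qed

text \<open>Newton's scheme: the correction e(x) times the product of all y - k vanishes on the
  earlier k, and \<open>prod_diff_dvd\<close> makes the required e a polynomial.\<close>

lemma interpolation:
  assumes "finite S" "\<And>f. f \<in> S \<Longrightarrow> degree f \<le> 1"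
    and "\<And>f h. f \<in> S \<Longrightarrow> h \<in> S \<Longrightarrow> f \<noteq> h \<Longrightarrow> \<exists>a\<in>D. poly f a = poly h a"
  shows "\<exists>g. total_degree_less m g \<and> (\<forall>f\<in>S. poly g f = field_value f)"
  using assms
proof (induction S rule: finite_induct)
  case empty
  show ?case by (rule exI[of _ 0]) (simp add: total_degree_less_def)
next
  case (insert l S)
  then obtain g where g: "total_degree_less m g" "\<And>f. f \<in> S \<Longrightarrow> poly g f = field_value f"
    by auto
  have "(\<Prod>k\<in>S. l - k) dvd field_value l - poly g l"
  proof (rule prod_diff_dvd)
    fix k assume "k \<in> S"
    then show "\<exists>a\<in>D. poly k a = poly l a" using insert.hyps insert.prems(2)[of k l] by auto
  qed (use insert.hyps insert.prems g in auto)
  then obtain e where e: "field_value l - poly g l = (\<Prod>k\<in>S. l - k) * e" by (auto elim: dvdE)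
  define P where "P = (\<Prod>k\<in>S. [:- k, 1:])"
  \<comment> \<open>A constant difference with a zero would be 0. So the product of the l - k has
    degree exactly \<open>card S\<close>, and as e times it has degree below \<open>m\<close>, e is
    small enough for the total degree bound.\<close>
  have deg: "degree (l - k) = 1" if k: "k \<in> S" for k
  proof -
    have "degree (l - k) \<le> 1" using k insert.prems by (simp add: degree_diff_le)
    moreover have "degree (l - k) \<noteq> 0"
    proof
      assume "degree (l - k) = 0"
      then obtain c where c: "l - k = [:c:]" by (auto elim: degree_eq_zeroE)
      obtain a where "poly l a = poly k a" using k insert by auto metis
      then have "poly (l - k) a = 0" by simp
      with c k insert.hyps show False by auto
    qed
    ultimately show ?thesis by simp
  qed
  have "total_degree_less m (smult e P)"
  proof (cases "e = 0")
    case False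
    have "degree (poly g l) < m"
      using degree_poly_total_degree_less[OF g(1)] insert.prems D by auto
    then have "degree ((\<Prod>k\<in>S. l - k) * e) < m"
      using degree_field_value[of l] insert.prems e by (metis degree_diff_less insertCI)
    moreover have "(\<Prod>k\<in>S. l - k) \<noteq> 0" using insert.hyps by auto
    moreover have "degree (\<Prod>k\<in>S. l - k) = card S"
      using deg insert.hyps by (subst degree_prod_sum_eq) auto
    ultimately have "degree e + Suc (card S) \<le> m" using False by (simp add: degree_mult_eq)
    then show ?thesis
      using total_degree_less_mono total_degree_less_smult total_degree_less_prod[of S] insert
      unfolding P_def by (metis insertCI)
  qed (simp add: total_degree_less_def)
  then have "total_degree_less m (g + smult e P)" using g total_degree_less_add by blast
  moreover have "poly (g + smult e P) l = field_value l"
    using e by (simp add: P_def poly_prod algebra_simps)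
  moreover have "poly (g + smult e P) f = field_value f" if "f \<in> S" for f
    using that g insert.hyps by (simp add: P_def poly_prod prod_zero_iff)
  ultimately show ?case by blast
qed

text \<open>Subtracting one member from the whole family keeps all agreements, so this settles the
  claim for an arbitrary member.\<close>

lemma exists_lonely_root:
  assumes S: "finite S" "\<And>f. f \<in> S \<Longrightarrow> degree f \<le> 1"
    and meet: "\<And>f h. f \<in> S \<Longrightarrow> h \<in> S \<Longrightarrow> f \<noteq> h \<Longrightarrow> \<exists>a\<in>D. poly f a = poly h a"
    and zero: "0 \<in> S"
  shows "\<exists>a\<in>D. \<forall>f\<in>S - {0}. poly f a \<noteq> 0"
proof (rule ccontr)
  assume "\<not> ?thesis"
  then have crowded: "\<exists>f\<in>S - {0}. poly f a = 0" if "a \<in> D" for a using that by blast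
  obtain g where g: "total_degree_less m g" "\<And>f. f \<in> S \<Longrightarrow> poly g f = field_value f"
    using interpolation[OF S meet] by blast
  obtain c g1 where c: "g = pCons c g1" by (cases g)
  \<comment> \<open>\<open>field_value 0 = 0\<close> says g(x, 0) = 0, so y divides g.\<close>
  with g(2)[OF zero] have g1: "g = pCons 0 g1" by (simp add: field_value_def)
  define h where "h = coeff g1 0"
  have h_deg: "coeff h i = 0" if "i \<ge> m - 1" for i
  proof (rule ccontr)
    assume "coeff h i \<noteq> 0"
    then have "coeff (coeff g 1) i \<noteq> 0" by (simp add: g1 h_def)
    then have "i + 1 < m" using g(1) unfolding total_degree_less_def by blast
    with that show False by simp
  qed
  have h_val: "poly h a = (1 - of_nat m) * poly (pderiv q) a" if a: "a \<in> D" for a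
  proof -
    obtain f where f: "f \<in> S" "f \<noteq> 0" "poly f a = 0" using crowded[OF a] by blast
    define r where "r = (\<Prod>a'\<in>D - {a}. [:- a', 1:])"
    have q': "q = [:- a, 1:] * r" using a D by (simp add: q r_def prod.remove)
    have fa: "f = pderiv f * [:- a, 1:]" using degree_le_1_expand[of f a] f S by simp
    \<comment> \<open>On f both sides contain the factor f, since f' (x - a) = f. After cancelling
      it, evaluation at a, where f vanishes, leaves only the y-coefficient \<open>h\<close> of
      g.\<close>
    have "f * poly g1 f = f * pderiv q - of_nat m * r * (pderiv f * [:- a, 1:])"
      using g(2)[OF f(1)] unfolding field_value_def g1
      by (subst (asm) (2) q') (simp add: mult_ac del: mult_pCons_left mult_pCons_right)
    also have "\<dots> = f * (pderiv q - of_nat m * r)"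
      by (simp only: fa[symmetric]) (simp add: algebra_simps)
    finally have "poly g1 f = pderiv q - of_nat m * r" using f(2) by simp
    moreover have "poly (poly g1 f) a = poly h a"
      using f(3) by (cases g1) (simp add: h_def)
    moreover have "poly (pderiv q) a = poly r a"
      by (simp add: q' pderiv_mult pderiv_pCons del: mult_pCons_left)
    ultimately have "poly h a = poly (pderiv q - of_nat m * r) a" by simp
    with \<open>poly (pderiv q) a = poly r a\<close> show ?thesis by (simp add: algebra_simps)
  qed
  define u where "u = h - smult (1 - of_nat m) (pderiv q)"
  \<comment> \<open>\<open>u\<close> has degree below \<open>m\<close> but vanishes at the
    \<open>m\<close> points of \<open>D\<close>.\<close>
  have "u = 0"
  proof (rule ccontr)
    assume "u \<noteq> 0"
    have "coeff u i = 0" if "i \<ge> m" for i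
      using that h_deg[of i] q_coeffs(1) by (simp add: u_def coeff_pderiv coeff_eq_0)
    then have "degree u < m" using D by (intro degree_lessI) auto
    moreover have "D \<subseteq> {a. poly u a = 0}" using h_val by (auto simp: u_def)
    then have "card D \<le> degree u"
      using card_mono[OF poly_roots_finite[OF \<open>u \<noteq> 0\<close>]] card_poly_roots_bound[OF \<open>u \<noteq> 0\<close>]
      by (meson le_trans)
    ultimately show False using D by simp
  qed
  \<comment> \<open>\<open>h\<close> contributes nothing in degree m - 1, whereas
    \<open>pderiv q\<close> has coefficient m there.\<close>
  then have "coeff u (m - 1) = 0" by simp
  moreover have "Suc (m - 1) = m" using D by simp
  ultimately have "(1 - of_nat m) * (of_nat m :: 'k) = 0"
    using h_deg[of "m - 1"] q_coeffs(2) by (simp add: u_def coeff_pderiv)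
  then show False using D by (auto simp: of_nat_eq_1_iff[symmetric] simp del: of_nat_eq_1_iff)
qed

end


section \<open>Points and lines of the projective plane through linear algebra\<close>

lemma subspace_scale_cancel:
  fixes W :: "('k::field ^ 'n) set"
  assumes "vec.subspace W" "k *s x \<in> W" "k \<noteq> 0"
  shows "x \<in> W"
  using vec.subspace_scale[OF assms(1,2), of "inverse k"] assms(3) by simp

lemma dim_UNIV_3: "vec.dim (UNIV :: ('k::field ^ 3) set) = 3"
  by (simp only: vec_dim_card) simp

lemma span_eq_UNIV_3:
  fixes B :: "('k::field ^ 3) set"
  shows "vec.dim B = 3 \<Longrightarrow> vec.span B = UNIV"
  by (metis dim_UNIV_3 vec.dim_eq_full vec.span_UNIV)

lemma subspace_combination:
  assumes "vec.subspace W" "x \<in> W" "y \<in> W"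
  shows "r *s x + s *s y \<in> W"
  using assms by (intro vec.subspace_add vec.subspace_scale)

text \<open>A plane and a vector outside it span the whole space. This supplies the coordinates of
  the lines below.\<close>

lemma plane_shift:
  fixes W :: "('k::field ^ 3) set"
  assumes W: "vec.subspace W" "vec.dim W = 2" and x: "x \<notin> W"
  shows "\<exists>t. v + t *s x \<in> W"
proof -
  have "vec.dim (insert x W) = 3" using W x by (simp add: vec.dim_insert vec.span_eq_iff[THEN iffD2])
  then have "v \<in> vec.span (insert x W)" by (simp add: span_eq_UNIV_3)
  then obtain k where "v - k *s x \<in> W"
    using W by (auto simp: vec.span_breakdown_eq vec.span_eq_iff[THEN iffD2])
  then show ?thesis by (intro exI[of _ "- k"]) simp
qed

lemma plane_eqI:
  fixes W :: "('k::field ^ 3) set"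
  assumes "vec.subspace W" "vec.dim W = 2" "vec.subspace W'" "vec.dim W' = 2" "W \<subseteq> W'"
  shows "W = W'"
  using assms by (intro vec.subspace_dim_equal) auto

lemma span_point: "v \<noteq> 0 \<Longrightarrow> vec.span {v} \<in> proj_points"
  by (simp add: proj_points_def)

lemma pointE:
  assumes "P \<in> proj_points"
  obtains v where "v \<noteq> 0" "P = vec.span {v}"
proof -
  have P: "vec.subspace P" "vec.dim P = 1" using assms by (auto simp: proj_points_def)
  then obtain v where v: "v \<in> P" "v \<noteq> 0"
    by (metis One_nat_def insertI1 subsetI vec.dim_eq_0 zero_neq_one singleton_iff)
  have "vec.span {v} = P"
    using v P by (intro vec.subspace_dim_equal) (auto simp: vec.span_minimal)
  with v that show ?thesis by blast
qed

text \<open>The union of the points of a line is its defining plane: each nonzero vector of the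
  plane spans a point of the line, and 0 lies in every point. Incidences thus become statements
  about vectors.\<close>

lemma line_plane:
  assumes "L \<in> proj_lines"
  shows "vec.subspace (\<Union>L)" "vec.dim (\<Union>L) = 2" "L = {P \<in> proj_points. P \<subseteq> \<Union>L}"
proof -
  obtain W where W: "vec.subspace W" "vec.dim W = 2" "L = {P \<in> proj_points. P \<subseteq> W}"
    using assms by (auto simp: proj_lines_def)
  have in_U: "v \<in> \<Union>L" if "v \<in> W" "v \<noteq> 0" for v
  proof -
    have "vec.span {v} \<in> L" using that W by (simp add: span_point vec.span_minimal)
    then show ?thesis using vec.span_base[of v "{v}"] by blast
  qed
  obtain w where w: "w \<in> W" "w \<noteq> 0"
    using W by (metis subsetI vec.dim_eq_0 zero_neq_numeral singleton_iff)
  have "vec.span {w} \<in> L" using w W by (simp add: span_point vec.span_minimal)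
  then have "0 \<in> \<Union>L" using vec.span_zero by blast
  with in_U have "\<Union>L = W" using W(3) by blast
  with W show "vec.subspace (\<Union>L)" "vec.dim (\<Union>L) = 2" "L = {P \<in> proj_points. P \<subseteq> \<Union>L}"
    by auto
qed

lemma line_eqI:
  assumes L: "L \<in> proj_lines" "L' \<in> proj_lines" and sub: "\<Union>L \<subseteq> \<Union>L'"
  shows "L = L'"
proof -
  have "\<Union>L = \<Union>L'"
    by (rule plane_eqI[OF line_plane(1,2)[OF L(1)] line_plane(1,2)[OF L(2)] sub])
  then show ?thesis using line_plane(3)[OF L(1)] line_plane(3)[OF L(2)] by metis
qed

lemma span_in_line_iff:
  assumes "L \<in> proj_lines" "v \<noteq> 0"
  shows "vec.span {v} \<in> L \<longleftrightarrow> v \<in> \<Union>L"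
proof
  assume "vec.span {v} \<in> L"
  then show "v \<in> \<Union>L" using vec.span_base[of v "{v}"] by blast
next
  assume "v \<in> \<Union>L"
  then show "vec.span {v} \<in> L"
    using line_plane[OF assms(1)] assms(2) span_point[of v] vec.span_minimal[of "{v}" "\<Union>L"] by blast
qed

lemma lines_meet:
  assumes "L \<in> proj_lines" "L' \<in> proj_lines"
  shows "\<exists>q. q \<in> L \<and> q \<in> L'"
proof -
  note W = line_plane[OF assms(1)] and W' = line_plane[OF assms(2)]
  have "\<exists>v. v \<noteq> 0 \<and> v \<in> \<Union>L \<and> v \<in> \<Union>L'"
  proof (cases "\<Union>L' \<subseteq> \<Union>L")
    case True
    obtain v where "v \<in> \<Union>L'" "v \<noteq> 0"
      using W'(2) by (metis subsetI vec.dim_eq_0 zero_neq_numeral singleton_iff)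
    with True show ?thesis by blast
  next
    case False
    then obtain x where x: "x \<in> \<Union>L'" "x \<notin> \<Union>L" by blast
    have "\<not> \<Union>L' \<subseteq> vec.span {x}"
    proof
      assume "\<Union>L' \<subseteq> vec.span {x}"
      then have "vec.dim (\<Union>L') \<le> vec.dim {x}" by (rule vec.dim_mono)
      with W'(2) show False by (simp split: if_splits)
    qed
    \<comment> \<open>Moving y along x stays in the plane of \<open>L'\<close> and reaches that of
      \<open>L\<close>; independence of x and y keeps the result nonzero.\<close>
    then obtain y where y: "y \<in> \<Union>L'" "y \<notin> vec.span {x}" by blast
    obtain t where t: "y + t *s x \<in> \<Union>L" using plane_shift[OF W(1,2) x(2)] by blast
    have "y + t *s x \<in> \<Union>L'" using x(1) y(1) W'(1) by (intro vec.subspace_add vec.subspace_scale)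
    moreover have "y + t *s x \<noteq> 0"
    proof
      assume "y + t *s x = 0"
      then have "y = (- t) *s x" by (simp add: eq_neg_iff_add_eq_0)
      with y(2) show False by (metis vec.span_base vec.span_scale singletonI)
    qed
    ultimately show ?thesis using t by blast
  qed
  then show ?thesis using span_in_line_iff assms by metis
qed

lemma line_unique:
  assumes L: "L \<in> proj_lines" "L' \<in> proj_lines" and "p \<noteq> q"
    and pq: "p \<in> L" "p \<in> L'" "q \<in> L" "q \<in> L'"
  shows "L = L'"
proof -
  note W = line_plane[OF L(1)] and W' = line_plane[OF L(2)]
  have "p \<in> proj_points" "q \<in> proj_points" using pq W(3) by blast+
  then obtain u v where u: "u \<noteq> 0" "p = vec.span {u}" and v: "v \<noteq> 0" "q = vec.span {v}"
    by (meson pointE)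
  have "v \<notin> vec.span {u}"
  proof
    assume "v \<in> vec.span {u}"
    then have "vec.span {v} = vec.span {u}"
      using u v by (intro vec.subspace_dim_equal) (auto simp: vec.span_minimal)
    with u v \<open>p \<noteq> q\<close> show False by simp
  qed
  then have dim: "vec.dim (vec.span {v, u}) = 2" using u by (simp add: vec.dim_insert)
  have "{v, u} \<subseteq> \<Union>L" "{v, u} \<subseteq> \<Union>L'" using pq u v L span_in_line_iff by auto
  then have "vec.span {v, u} = \<Union>L" "vec.span {v, u} = \<Union>L'"
    by (metis plane_eqI vec.span_minimal vec.subspace_span dim W(1,2),
        metis plane_eqI vec.span_minimal vec.subspace_span dim W'(1,2))
  then show ?thesis using W(3) W'(3) by simp
qed

section \<open>Affine coordinates at the modular point\<close>

lemma spanning_triple: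
  fixes e :: "'k::field ^ 3"
  assumes "e \<noteq> 0"
  shows "\<exists>u w. \<forall>v. \<exists>r s t. v = r *s e + s *s u + t *s w"
proof -
  have ex: "\<exists>x. x \<notin> vec.span B" if "vec.dim B < 3" for B :: "('k ^ 3) set"
  proof (rule ccontr)
    assume "\<not> ?thesis"
    then have "vec.span B = UNIV" by blast
    then show False using that by (metis dim_UNIV_3 vec.dim_span less_irrefl)
  qed
  obtain u where u: "u \<notin> vec.span {e}" using ex[of "{e}"] assms by auto
  then have 2: "vec.dim {u, e} = 2" using assms by (simp add: vec.dim_insert)
  obtain w where w: "w \<notin> vec.span {u, e}" using ex[of "{u, e}"] 2 by auto
  then have "vec.dim {w, u, e} = 3" using 2 by (simp add: vec.dim_insert)
  then have span: "vec.span {w, u, e} = UNIV" by (rule span_eq_UNIV_3)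
  have "\<exists>r s t. v = r *s e + s *s u + t *s w" for v
  proof -
    have "v \<in> vec.span {w, u, e}" using span by simp
    then obtain t s r where "v - t *s w - s *s u - r *s e = 0"
      by (auto simp: vec.span_breakdown_eq)
    then have "v = r *s e + s *s u + t *s w" by (simp add: algebra_simps)
    then show ?thesis by blast
  qed
  then show ?thesis by blast
qed

text \<open>A \<open>w\<close> on none of the lines of \<open>V\<close> puts no line of \<open>V\<close> at infinity.\<close>

lemma affine_frame:
  fixes e :: "'k::field_char_0 ^ 3"
  assumes e: "e \<noteq> 0" and V: "finite V" "V \<subseteq> proj_lines" "\<And>K. K \<in> V \<Longrightarrow> e \<in> \<Union>K"
  shows "\<exists>u w. (\<forall>v. \<exists>r s t. v = r *s e + s *s u + t *s w) \<and> (\<forall>K\<in>V. w \<notin> \<Union>K)"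
proof -
  obtain u w where uw: "\<And>v. \<exists>r s t. v = r *s e + s *s u + t *s w"
    using spanning_triple[OF e] by blast
  \<comment> \<open>Each K excludes at most one z: two would put u, then w, and with e the whole
    space into the plane of K. An infinite field leaves a good z.\<close>
  define bad where "bad K = {z. w + z *s u \<in> \<Union>K}" for K
  have "finite (bad K)" if K: "K \<in> V" for K
  proof -
    note W = line_plane[of K]
    have K': "K \<in> proj_lines" using K V by blast
    have "z = z'" if z: "z \<in> bad K" "z' \<in> bad K" for z z'
    proof (rule ccontr)
      assume "z \<noteq> z'"
      have "(w + z *s u) - (w + z' *s u) \<in> \<Union>K"
        using z W(1)[OF K'] unfolding bad_def by (metis mem_Collect_eq vec.subspace_diff)
      then have "(z - z') *s u \<in> \<Union>K" by (simp add: vec.scale_left_diff_distrib)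
      then have u: "u \<in> \<Union>K" using subspace_scale_cancel[OF W(1)[OF K']] \<open>z \<noteq> z'\<close> by fastforce
      then have "w + z *s u - z *s u \<in> \<Union>K"
        using z W(1)[OF K'] unfolding bad_def
        by (metis mem_Collect_eq vec.subspace_diff vec.subspace_scale)
      then have w: "w \<in> \<Union>K" by simp
      have "v \<in> \<Union>K" for v
      proof -
        obtain r s t where "v = r *s e + s *s u + t *s w" using uw by blast
        then show ?thesis using u w V(3)[OF K] W(1)[OF K']
          by (simp only:) (intro vec.subspace_add vec.subspace_scale)
      qed
      then have "\<Union>K = UNIV" by blast
      then show False using W(2)[OF K'] by (simp add: dim_UNIV_3 del: vec.dim_UNIV)
    qed
    then show ?thesis by (metis finite.simps is_singletonI' is_singleton_def)
  qed
  then have "finite (\<Union>K\<in>V. bad K)" using V by blast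
  then obtain z where z: "z \<notin> (\<Union>K\<in>V. bad K)"
    using ex_new_if_finite infinite_UNIV_char_0 by blast
  have "\<exists>r s t. v = r *s e + s *s u + t *s (w + z *s u)" for v
  proof -
    obtain r s t where "v = r *s e + s *s u + t *s w" using uw by blast
    then have "v = r *s e + (s - t * z) *s u + t *s (w + z *s u)"
      by (simp add: vec.scale_left_diff_distrib vec.scale_right_distrib)
    then show ?thesis by blast
  qed
  then show ?thesis using z by (intro exI[of _ u] exI[of _ "w + z *s u"]) (auto simp: bad_def)
qed

text \<open>In the chart s = 1 of k e + s u + t w, with x = t and y = k, a line K of
  \<open>V\<close> is x = \<open>a K\<close> and a line L of \<open>N\<close> is y =
  \<open>d L\<close> + \<open>c L\<close> x, so \<open>exists_lonely_root\<close> applies.\<close>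

lemma exists_lonely_line:
  fixes V N :: "'k::field_char_0 pline set"
  assumes V: "finite V" "V \<subseteq> proj_lines" "card V \<ge> 2" "\<And>K. K \<in> V \<Longrightarrow> p \<in> K"
    and N: "finite N" "N \<subseteq> proj_lines" "\<And>L. L \<in> N \<Longrightarrow> p \<notin> L"
    and modular: "\<And>L L'. L \<in> N \<Longrightarrow> L' \<in> N \<Longrightarrow> L \<noteq> L' \<Longrightarrow> \<exists>K\<in>V. L \<inter> L' \<subseteq> K"
    and L0: "L0 \<in> N"
  shows "\<exists>K\<in>V. \<forall>L\<in>N - {L0}. L0 \<inter> K \<inter> L = {}"
proof -
  have "V \<noteq> {}" using V(3) by auto
  then have "p \<in> proj_points" using V line_plane(3) by blast
  then obtain e where e: "e \<noteq> 0" "p = vec.span {e}" by (rule pointE)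
  have eK: "e \<in> \<Union>K" if "K \<in> V" for K using that V e span_in_line_iff by blast
  have eL: "e \<notin> \<Union>L" if "L \<in> N" for L using that N e span_in_line_iff by blast
  obtain u w where uw: "\<And>v. \<exists>r s t. v = r *s e + s *s u + t *s w"
    and w: "\<And>K. K \<in> V \<Longrightarrow> w \<notin> \<Union>K"
    using affine_frame[OF e(1) V(1,2) eK] by blast
  have subK: "vec.subspace (\<Union>K)" "vec.dim (\<Union>K) = 2" if "K \<in> V" for K
    using that V line_plane by blast+
  have subL: "vec.subspace (\<Union>L)" "vec.dim (\<Union>L) = 2" if "L \<in> N" for L
    using that N line_plane by blast+
  obtain a where a: "\<And>K. K \<in> V \<Longrightarrow> u + a K *s w \<in> \<Union>K"
  proof -
    have "\<forall>K\<in>V. \<exists>t. u + t *s w \<in> \<Union>K" using plane_shift subK w by blast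
    then show ?thesis using that by (metis bchoice)
  qed
  obtain c where c: "\<And>L. L \<in> N \<Longrightarrow> w + c L *s e \<in> \<Union>L"
  proof -
    have "\<forall>L\<in>N. \<exists>t. w + t *s e \<in> \<Union>L" using plane_shift subL eL by blast
    then show ?thesis using that by (metis bchoice)
  qed
  obtain d where d: "\<And>L. L \<in> N \<Longrightarrow> u + d L *s e \<in> \<Union>L"
  proof -
    have "\<forall>L\<in>N. \<exists>t. u + t *s e \<in> \<Union>L" using plane_shift subL eL by blast
    then show ?thesis using that by (metis bchoice)
  qed
  have on_L: "k = d L * s + c L * t" if L: "L \<in> N" and v: "k *s e + s *s u + t *s w \<in> \<Union>L" for L k s t
  proof (rule ccontr)
    assume "k \<noteq> d L * s + c L * t"
    have "(k *s e + s *s u + t *s w) - (s *s (u + d L *s e) + t *s (w + c L *s e)) \<in> \<Union>L"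
      by (rule vec.subspace_diff[OF subL(1)[OF L] v
            subspace_combination[OF subL(1)[OF L] d[OF L] c[OF L]]])
    also have "(k *s e + s *s u + t *s w) - (s *s (u + d L *s e) + t *s (w + c L *s e)) =
        (k - (d L * s + c L * t)) *s e"
      by (simp add: vec_eq_iff algebra_simps)
    finally have "e \<in> \<Union>L"
      using \<open>k \<noteq> _\<close> subL(1)[OF L] subspace_scale_cancel by fastforce
    with eL L show False by blast
  qed
  have on_K: "t = s * a K" if K: "K \<in> V" and v: "k *s e + s *s u + t *s w \<in> \<Union>K" for K k s t
  proof (rule ccontr)
    assume "t \<noteq> s * a K"
    have "(k *s e + s *s u + t *s w) - (k *s e + s *s (u + a K *s w)) \<in> \<Union>K"
      by (rule vec.subspace_diff[OF subK(1)[OF K] v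
            subspace_combination[OF subK(1)[OF K] eK[OF K] a[OF K]]])
    also have "(k *s e + s *s u + t *s w) - (k *s e + s *s (u + a K *s w)) = (t - s * a K) *s w"
      by (simp add: vec_eq_iff algebra_simps)
    finally have "w \<in> \<Union>K"
      using \<open>t \<noteq> _\<close> subK(1)[OF K] subspace_scale_cancel by fastforce
    with w K show False by blast
  qed
  have inj_a: "inj_on a V"
  proof (rule inj_onI)
    fix K K' assume K: "K \<in> V" "K' \<in> V" "a K = a K'"
    have "\<Union>K \<subseteq> \<Union>K'"
    proof
      fix v assume v: "v \<in> \<Union>K"
      obtain k s t where v': "v = k *s e + s *s u + t *s w" using uw by blast
      with v K on_K have "t = s * a K'" by metis
      then have "v = k *s e + s *s (u + a K' *s w)" by (simp add: v' vec_eq_iff algebra_simps)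
      then show "v \<in> \<Union>K'"
        using subspace_combination[OF subK(1)[OF K(2)] eK[OF K(2)] a[OF K(2)]] by (simp only:)
    qed
    then show "K = K'" using K V by (intro line_eqI) auto
  qed
  define f where "f L = [:d L, c L:]" for L
  have inj_f: "inj_on f N"
  proof (rule inj_onI)
    fix L L' assume L: "L \<in> N" "L' \<in> N" "f L = f L'"
    have "\<Union>L \<subseteq> \<Union>L'"
    proof
      fix v assume v: "v \<in> \<Union>L"
      obtain k s t where v': "v = k *s e + s *s u + t *s w" using uw by blast
      have "k = d L * s + c L * t" using v v' L on_L by blast
      then have "k = d L' * s + c L' * t" using L by (simp add: f_def)
      then have "v = s *s (u + d L' *s e) + t *s (w + c L' *s e)"
        by (simp add: v' vec_eq_iff algebra_simps)
      then show "v \<in> \<Union>L'"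
        using subspace_combination[OF subL(1)[OF L(2)] d[OF L(2)] c[OF L(2)]] by (simp only:)
    qed
    then show "L = L'" using L N by (intro line_eqI) auto
  qed
  have meet: "poly (f L) (a K) = poly (f L') (a K)"
    if L: "L \<in> N" "L' \<in> N" and K: "K \<in> V" and q: "q \<in> L" "q \<in> L'" "q \<in> K" for L L' K q
  proof -
    have "q \<in> proj_points" using q(3) K V line_plane(3) by blast
    then obtain v where v: "v \<noteq> 0" "q = vec.span {v}" by (rule pointE)
    then have v_in: "v \<in> \<Union>L" "v \<in> \<Union>L'" "v \<in> \<Union>K"
      using q L K N V span_in_line_iff by blast+
    obtain k s t where v': "v = k *s e + s *s u + t *s w" using uw by blast
    have t: "t = s * a K" using v_in(3) K on_K v' by blast
    have k: "k = d L * s + c L * t" "k = d L' * s + c L' * t"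
      using v_in L on_L v' by blast+
    \<comment> \<open>If s were 0, then t and k would vanish too: the common point is not at
      infinity.\<close>
    have "s \<noteq> 0" using v(1) v' t k by auto
    moreover have "s * poly (f L) (a K) = s * poly (f L') (a K)"
      using k t by (simp add: f_def algebra_simps)
    ultimately show ?thesis by simp
  qed
  have "\<exists>b\<in>a ` V. \<forall>h\<in>(\<lambda>L. f L - f L0) ` N - {0}. poly h b \<noteq> 0"
  proof (rule exists_lonely_root)
    show "2 \<le> card (a ` V)" using V inj_a by (simp add: card_image)
    show "degree h \<le> 1" if "h \<in> (\<lambda>L. f L - f L0) ` N" for h
      using that by (auto simp: f_def)
    show "\<exists>b\<in>a ` V. poly g b = poly h b"
      if gh: "g \<in> (\<lambda>L. f L - f L0) ` N" "h \<in> (\<lambda>L. f L - f L0) ` N" "g \<noteq> h" for g h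
    proof -
      obtain L L' where L: "L \<in> N" "L' \<in> N" "g = f L - f L0" "h = f L' - f L0" using gh by blast
      with gh(3) have "L \<noteq> L'" by metis
      with modular[OF L(1,2)] obtain K where K: "K \<in> V" "L \<inter> L' \<subseteq> K" by blast
      \<comment> \<open>An actual common point is required, as an empty intersection would lie in
        any K.\<close>
      obtain q where "q \<in> L" "q \<in> L'" using lines_meet L N by blast
      with K L meet[of L L' K q] show ?thesis by auto
    qed
    show "0 \<in> (\<lambda>L. f L - f L0) ` N" using L0 by force
  qed (use V N in auto)
  then obtain K where K: "K \<in> V" "\<And>h. h \<in> (\<lambda>L. f L - f L0) ` N - {0} \<Longrightarrow> poly h (a K) \<noteq> 0"
    by blast
  have "L0 \<inter> K \<inter> L = {}" if L: "L \<in> N - {L0}" for L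
  proof (rule ccontr)
    assume "L0 \<inter> K \<inter> L \<noteq> {}"
    then obtain q where "q \<in> L0" "q \<in> K" "q \<in> L" by blast
    then have "poly (f L - f L0) (a K) = 0" using meet[of L L0 K q] L L0 K(1) by auto
    moreover have "f L \<noteq> f L0" using inj_f L L0 by (auto dest: inj_onD)
    ultimately show False using K(2) L by force
  qed
  with K(1) show ?thesis by blast
qed

section \<open>Double points and the deletion of a line\<close>

text \<open>\<open>card\<close> of an infinite set is 0, so exhibiting a double point gives
  \<open>n2 > 0\<close> only together with finiteness.\<close>

lemma finite_double_points:
  fixes A :: "'k::field pline set"
  assumes "finite A" "A \<subseteq> proj_lines"
  shows "finite (double_points A)"
proof (rule finite_subset)
  let ?I = "\<Union>(L, L')\<in>{(L, L'). L \<in> A \<and> L' \<in> A \<and> L \<noteq> L'}. L \<inter> L'"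
  show "double_points A \<subseteq> ?I"
  proof
    fix q assume "q \<in> double_points A"
    then obtain L L' where "lines_through A q = {L, L'}" "L \<noteq> L'"
      by (auto simp: double_points_def card_2_iff)
    then show "q \<in> ?I" unfolding lines_through_def by blast
  qed
  have "finite (L \<inter> L')" if "L \<in> A" "L' \<in> A" "L \<noteq> L'" for L L'
  proof -
    have "p = q" if "p \<in> L \<inter> L'" "q \<in> L \<inter> L'" for p q
      using line_unique[of L L' p q] that \<open>L \<in> A\<close> \<open>L' \<in> A\<close> \<open>L \<noteq> L'\<close> assms by blast
    then show ?thesis by (metis finite.simps is_singletonI' is_singleton_def)
  qed
  moreover have "finite {(L, L'). L \<in> A \<and> L' \<in> A \<and> L \<noteq> L'}"
    by (rule finite_subset[of _ "A \<times> A"]) (use assms in auto)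
  ultimately show "finite ?I" by auto
qed

text \<open>At the point where \<open>L0\<close> meets \<open>K\<close>, a further line of
  \<open>V\<close> would share two points with \<open>K\<close>, and a further line of
  \<open>N\<close> would contradict loneliness.\<close>

lemma lonely_line_double_point:
  fixes V N :: "'k::field pline set"
  assumes V: "finite V" "V \<subseteq> proj_lines" "\<And>K. K \<in> V \<Longrightarrow> p \<in> K"
    and N: "finite N" "N \<subseteq> proj_lines" "\<And>L. L \<in> N \<Longrightarrow> p \<notin> L"
    and L0: "L0 \<in> N" and K: "K \<in> V" and lonely: "\<And>L. L \<in> N - {L0} \<Longrightarrow> L0 \<inter> K \<inter> L = {}"
  shows "n2 (V \<union> N) > 0"
proof -
  obtain q where q: "q \<in> L0" "q \<in> K" using lines_meet[of L0 K] L0 K V N by blast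
  have "q \<noteq> p" using q L0 N by blast
  have "L0 \<noteq> K" using L0 K V N by blast
  have "lines_through (V \<union> N) q = {L0, K}"
  proof
    show "lines_through (V \<union> N) q \<subseteq> {L0, K}"
    proof
      fix L assume "L \<in> lines_through (V \<union> N) q"
      then consider "L \<in> V" "q \<in> L" | "L \<in> N" "q \<in> L" by (auto simp: lines_through_def)
      then show "L \<in> {L0, K}"
      proof cases
        case 1
        then show ?thesis using line_unique[of L K q p] q K V \<open>q \<noteq> p\<close> by blast
      next
        case 2
        then show ?thesis using lonely[of L] q by blast
      qed
    qed
  qed (use q L0 K in \<open>auto simp: lines_through_def\<close>)
  moreover have "q \<in> proj_points" using q(2) K V line_plane(3) by blast
  ultimately have "q \<in> double_points (V \<union> N)"
    using \<open>L0 \<noteq> K\<close> by (simp add: double_points_def)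
  moreover have "finite (double_points (V \<union> N))" using V N by (intro finite_double_points) auto
  ultimately show ?thesis unfolding n2_def by (metis card_gt_0_iff empty_iff)
qed

theorem theorem4p4:
  fixes \<A> :: "('k::field_char_0) pline set"
    and p :: "'k ppoint" and H :: "'k pline" and m :: nat
  assumes "line_arrangement \<A>"
    and "essential \<A>"
    and "p \<in> L2 \<A>"
    and "supersolvable_with_modular_point \<A> p"
    and "mu \<A> p = m - 1"
    and "m - 1 \<ge> 1"
    and "H \<in> \<A>"
    and "\<not> pencil (\<A> - {H})"
  shows "n2 (\<A> - {H}) > 0"
proof -
  define V where "V = lines_through \<A> p"
  define N where "N = \<A> - V"
  have A: "finite \<A>" "\<A> \<subseteq> proj_lines" using assms(1) by (auto simp: line_arrangement_def)
  have p: "p \<in> proj_points" using assms(3) by (simp add: L2_def)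
  have V: "finite V" "V \<subseteq> proj_lines" "\<And>K. K \<in> V \<Longrightarrow> p \<in> K" and "V \<subseteq> \<A>"
    using A by (auto simp: V_def lines_through_def)
  have N: "finite N" "N \<subseteq> proj_lines" "\<And>L. L \<in> N \<Longrightarrow> p \<notin> L"
    using A by (auto simp: N_def V_def lines_through_def)
  have card_V: "card V \<ge> 2" using assms(5,6) by (simp add: mu_def V_def)
  have modular: "\<exists>K\<in>V. L \<inter> L' \<subseteq> K" if "L \<in> N" "L' \<in> N" "L \<noteq> L'" for L L'
  proof -
    have "\<exists>!K. K \<in> V \<and> L \<inter> L' \<subseteq> K"
      using assms(4) that unfolding supersolvable_with_modular_point_def N_def V_def by simp
    then show ?thesis by (elim ex1E) blast
  qed
  show ?thesis
  proof (cases "H \<in> V")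
    case False
    then have eq: "\<A> - {H} = V \<union> (N - {H})" using \<open>V \<subseteq> \<A>\<close> by (auto simp: N_def)
    have "N - {H} \<noteq> {}"
    proof
      assume "N - {H} = {}"
      then have "\<forall>L\<in>\<A> - {H}. p \<in> L" using eq V(3) by auto
      with p assms(8) show False unfolding pencil_def by blast
    qed
    then obtain L0 where L0: "L0 \<in> N - {H}" by blast
    have N': "finite (N - {H})" "N - {H} \<subseteq> proj_lines" "\<And>L. L \<in> N - {H} \<Longrightarrow> p \<notin> L"
      using N by auto
    have "\<exists>K\<in>V. \<forall>L\<in>(N - {H}) - {L0}. L0 \<inter> K \<inter> L = {}"
      by (rule exists_lonely_line[OF V(1,2) card_V V(3) N' _ L0]) (use modular in simp_all)
    then obtain K where "K \<in> V" "\<forall>L\<in>(N - {H}) - {L0}. L0 \<inter> K \<inter> L = {}"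
      by blast
    then show ?thesis unfolding eq by (intro lonely_line_double_point[OF V N' L0]) blast+
  next
    case True
    define V' where "V' = V - {H}"
    have V': "finite V'" "V' \<subseteq> proj_lines" "\<And>K. K \<in> V' \<Longrightarrow> p \<in> K"
      using V by (auto simp: V'_def)
    have eq: "\<A> - {H} = V' \<union> N" using \<open>V \<subseteq> \<A>\<close> True by (auto simp: N_def V'_def)
    show ?thesis
    proof (rule ccontr)
      assume no_double: "\<not> ?thesis"
      have not_lonely: "\<not> (\<forall>L\<in>N - {L0}. L0 \<inter> K \<inter> L = {})" if "K \<in> V'" "L0 \<in> N" for K L0
      proof
        assume lonely: "\<forall>L\<in>N - {L0}. L0 \<inter> K \<inter> L = {}"
        have "n2 (V' \<union> N) > 0"
          by (rule lonely_line_double_point[OF V' N that(2,1) bspec[OF lonely]])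
        with no_double eq show False by simp
      qed
      have lonely_H: "L0 \<inter> H \<inter> L = {}" if L: "L0 \<in> N" "L \<in> N - {L0}" for L0 L
      proof -
        \<comment> \<open>The claim for the full arrangement gives a lonely K, and
          \<open>not_lonely\<close> rules out every candidate except \<open>H\<close>.\<close>
        obtain K where K: "K \<in> V" "\<forall>L\<in>N - {L0}. L0 \<inter> K \<inter> L = {}"
          using exists_lonely_line[OF V(1,2) card_V V(3) N modular L(1)] by auto
        then have "K = H" using not_lonely[OF _ L(1)] unfolding V'_def by (metis DiffI singletonD)
        with K(2) L(2) show ?thesis by simp
      qed
      have modular': "\<exists>K\<in>V'. L \<inter> L' \<subseteq> K" if L: "L \<in> N" "L' \<in> N" "L \<noteq> L'" for L L'
      proof -
        obtain K where K: "K \<in> V" "L \<inter> L' \<subseteq> K" using modular[OF L] by blast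
        obtain q where "q \<in> L" "q \<in> L'" using lines_meet[of L L'] L N by blast
        then have "K \<noteq> H" using K(2) lonely_H[of L L'] L by blast
        with K show ?thesis by (auto simp: V'_def)
      qed
      have "N \<noteq> {}"
      proof
        assume "N = {}"
        then have "\<forall>L\<in>\<A> - {H}. p \<in> L" using eq V'(3) by auto
        with p assms(8) show False unfolding pencil_def by blast
      qed
      then obtain L0 where L0: "L0 \<in> N" by blast
      have "\<not> card V' \<ge> 2"
      proof
        assume "card V' \<ge> 2"
        from exists_lonely_line[OF V'(1,2) this V'(3) N modular' L0] not_lonely[OF _ L0]
        show False by simp
      qed
      moreover have "card V' \<ge> 1" using card_V True V(1) by (simp add: V'_def)
      ultimately have "card V' = 1" by simp
      \<comment> \<open>With only K left through p, modularity puts all intersections of lines of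
        \<open>N\<close> on K. Hence every line of \<open>N\<close> passes through the point q of
        \<open>L0\<close> on K, which gives a pencil.\<close>
      then obtain K where K: "V' = {K}" by (rule card_1_singletonE)
      obtain q where q: "q \<in> L0" "q \<in> K" using lines_meet[of L0 K] L0 K V' N by blast
      have "q \<in> L" if L: "L \<in> N" for L
      proof (cases "L = L0")
        case False
        obtain r where r: "r \<in> L" "r \<in> L0" using lines_meet[of L L0] L L0 N by blast
        with modular'[OF L L0 False] K have "r \<in> K" by blast
        moreover have "L0 \<noteq> K" using L0 K V' N by blast
        ultimately have "r = q" using line_unique[of L0 K r q] r q L0 K V' N by blast
        with r show ?thesis by simp
      qed (use q in simp)
      moreover have "q \<in> proj_points" using q(1) L0 N line_plane(3) by blast
      ultimately have "pencil (\<A> - {H})" using q(2) K by (auto simp: pencil_def eq)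
      with assms(8) show False by blast
    qed
  qed
qed

end
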